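(* Let $X$ be a subspace of a Hausdorff topological group $H$. If $X$ is a Lindelöf $\Sigma$-space and $X$ generates a dense subgroup of $H$, then $w(X)\leq w(H)\leq 2^{\psi(X)}$.
   Context: $w$ weight, $\psi$ pseudocharacter (infinite values). The Nagami number $Nag(Y)$ of a Tychonoff space $Y$ is the minimal cardinality of a family $\mathcal F$ of closed subsets of $\beta Y$ such that for every $y\in Y$ and $z\in\beta Y\setminus Y$ there is $F\in\mathcal F$ with $y\in F$, $z\notin F$; $Y$ is a Lindelöf $\Sigma$-space if $Nag(Y)\leq\omega$. *)

theory Defs
  imports "HOL-Analysis.Analysis" "HOL-Algebra.Generated_Groups"
begin

definition topological_group :: "('g, 'b) monoid_scheme \<Rightarrow> 'g topology \<Rightarrow> bool" where
  "topological_group G T \<longleftrightarrow> group G \<and> topspace T = carrier G \<and>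
     continuous_map (prod_topology T T) T (\<lambda>(x, y). x \<otimes>\<^bsub>G\<^esub> y) \<and>
     continuous_map T T (\<lambda>x. inv\<^bsub>G\<^esub> x)"

definition tychonoff_space :: "'a topology \<Rightarrow> bool" where
  "tychonoff_space Y \<longleftrightarrow> completely_regular_space Y \<and> Hausdorff_space Y"

definition stone_cech :: "'a topology \<Rightarrow> 'k topology \<Rightarrow> ('a \<Rightarrow> 'k) \<Rightarrow> bool" where
  "stone_cech Y K e \<longleftrightarrow> compact_space K \<and> Hausdorff_space K \<and> embedding_map Y K e \<and>
     K closure_of (e ` topspace Y) = topspace K \<and>
     (\<forall>f. continuous_map Y (top_of_set {0..1::real}) f \<longrightarrow>
        (\<exists>g. continuous_map K (top_of_set {0..1::real}) g \<and> (\<forall>y\<in>topspace Y. g (e y) = f y)))"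

text \<open>Lindelof Sigma-space: Nag(Y) \<le> \<omega>, i.e. there is a countable family of closed
  subsets of \<beta>Y separating points of Y from points of \<beta>Y \ Y.  \<beta>Y is realised on the
  type 'a set set (large enough to carry the z-ultrafilter model of \<beta>Y); since all
  Stone-Cech compactifications are homeomorphic over Y, the choice does not matter.\<close>
definition lindelof_sigma :: "'a topology \<Rightarrow> bool" where
  "lindelof_sigma Y \<longleftrightarrow> tychonoff_space Y \<and>
     (\<exists>(K :: 'a set set topology) e. stone_cech Y K e \<and>
        (\<exists>\<F>. countable \<F> \<and> (\<forall>F\<in>\<F>. closedin K F) \<and>
           (\<forall>y\<in>topspace Y. \<forall>z\<in>topspace K - e ` topspace Y.
               \<exists>F\<in>\<F>. e y \<in> F \<and> z \<notin> F)))"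

definition is_base :: "'a topology \<Rightarrow> 'a set set \<Rightarrow> bool" where
  "is_base T B \<longleftrightarrow> (\<forall>V\<in>B. openin T V) \<and>
     (\<forall>U x. openin T U \<and> x \<in> U \<longrightarrow> (\<exists>V\<in>B. x \<in> V \<and> V \<subseteq> U))"

end

(*
  X is covered by at most 2^omega compact sets K, and some countable family N of subsets of X
  contains, for each of these K and each open U containing K, an F with K <= F <= U (a network
  modulo the cover).  By Arhangelskii's theorem each K, hence X and the subgroup D generated by X,
  has at most 2^psi points.  By Wallace's theorem the property "countable network modulo a cover by
  compact sets" passes to products and inverses, hence to D.  For any regular space T with
  such a dense subset D of size at most 2^psi, two closed sets are separated on D by a countable
  union of sets F Int B, with F in N and B from a fixed family of 2^psi sets; the interiors of the
  closures of these unions form a base of T.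
*)
theory Submission
  imports Defs "HOL-Algebra.Free_Abelian_Groups"
begin

section \<open>Cardinality bounds\<close>

text \<open>Throughout, \<open>S\<close> stands for a set of size \<psi> and \<open>Pow S\<close>
  for 2^\<psi>; the counting rests on (2^\<psi>)^\<psi> = 2^\<psi>. The obstacle is that
  \<open>D\<close> may have as many as 2^\<psi> points, so the classical bound for the weight of a
  regular space, by the number of all subsets of a dense set, would only give 2^(2^\<psi>). Only
  2^\<psi> subsets of \<open>D\<close> may be used, and countable unions from a family of size
  2^\<psi> are affordable. This is what the countable network buys: a separation is made near one
  compact K, where finitely many open sets separating pairs of points of \<open>D\<close> are
  enough; it then persists on a whole network member F, and since there are countably many F,
  countably many such separations serve all of \<open>D\<close>. The pseudocharacter enters only
  through the size of \<open>D\<close>: the point separators are open sets of the ambient space, one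
  for each ordered pair of points.\<close>

lemma card_of_image_le:
  assumes "|A| \<le>o r"
  shows "|f ` A| \<le>o r"
  using assms card_of_image ordLeq_transitive by blast

lemma card_of_subset_le:
  assumes "A \<subseteq> B" "|B| \<le>o r"
  shows "|A| \<le>o r"
  using assms card_of_mono1 ordLeq_transitive by blast

text \<open>This is (2^\<kappa>)^\<kappa> = 2^(\<kappa> * \<kappa>) = 2^\<kappa> for \<kappa> the
  size of \<open>S\<close>. With \<open>A\<close> embedded into \<open>Pow S\<close> by
  \<open>f\<close>, a surjection \<open>g\<close> of \<open>S\<close> onto \<open>E\<close> is coded
  by the relation on \<open>S\<close> whose section at \<open>s\<close> is \<open>f (g s)\<close>,
  and \<open>\<phi>\<close> recovers \<open>E\<close> from the sections. The empty \<open>E\<close>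
  is added by hand, since it is not an image of the nonempty \<open>S\<close>.\<close>

lemma card_of_subsets_le_Pow:
  assumes S: "infinite S" and A: "|A| \<le>o |Pow S|"
  shows "|{E. E \<subseteq> A \<and> |E| \<le>o |S| }| \<le>o |Pow S|"
proof -
  obtain f where f: "inj_on f A" "f ` A \<subseteq> Pow S"
    using A card_of_ordLeq[of A "Pow S"] by blast
  define \<phi> where "\<phi> R = {a \<in> A. \<exists>s\<in>S. f a = R `` {s}}" for R
  have "{E. E \<subseteq> A \<and> |E| \<le>o |S| } \<subseteq> insert {} (\<phi> ` Pow (S \<times> S))"
  proof
    fix E assume "E \<in> {E. E \<subseteq> A \<and> |E| \<le>o |S| }"
    then have E: "E \<subseteq> A" "|E| \<le>o |S|" by auto
    show "E \<in> insert {} (\<phi> ` Pow (S \<times> S))"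
    proof (cases "E = {}")
      case False
      then obtain g where g: "g ` S = E" using card_of_ordLeq2 E(2) by metis
      define R where "R = {(s, t). s \<in> S \<and> t \<in> f (g s)}"
      have R: "R `` {s} = f (g s)" if "s \<in> S" for s using that by (auto simp: R_def)
      have "R \<in> Pow (S \<times> S)" using g E(1) f(2) by (force simp: R_def)
      moreover have "\<phi> R = E"
        using g E(1) inj_onD[OF f(1)] by (auto simp: \<phi>_def R)
      ultimately show ?thesis by blast
    qed simp
  qed
  then have "|{E. E \<subseteq> A \<and> |E| \<le>o |S| }| \<le>o |{{}} \<union> \<phi> ` Pow (S \<times> S)|"
    using card_of_mono1 by fastforce
  moreover have "|{{}} \<union> \<phi> ` Pow (S \<times> S)| \<le>o |Pow S|"
  proof (rule card_of_Un_ordLeq_infinite)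
    show "infinite (Pow S)" using S by simp
    show "|{{}}| \<le>o |Pow S|" by (rule card_of_singl_ordLeq) (rule Pow_not_empty)
    have "|S \<times> S| \<le>o |S|" using S card_of_Times_same_infinite ordIso_imp_ordLeq by blast
    then show "|\<phi> ` Pow (S \<times> S)| \<le>o |Pow S|"
      using card_of_image card_of_Pow_mono ordLeq_transitive by blast
  qed
  ultimately show ?thesis using ordLeq_transitive by blast
qed

lemma countable_card_of_le_infinite:
  assumes "infinite S" "countable C"
  shows "|C| \<le>o |S|"
proof -
  have "|C| \<le>o |UNIV :: nat set|"
    using assms(2) card_of_ordLeq[of C "UNIV :: nat set"] by (auto simp: countable_def)
  then show ?thesis using assms(1) infinite_iff_card_of_nat ordLeq_transitive by blast
qed

lemma card_of_countable_subsets_le_Pow: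
  assumes "infinite S" "|A| \<le>o |Pow S|"
  shows "|{E. E \<subseteq> A \<and> countable E}| \<le>o |Pow S|"
proof -
  have "{E. E \<subseteq> A \<and> countable E} \<subseteq> {E. E \<subseteq> A \<and> |E| \<le>o |S| }"
    using countable_card_of_le_infinite[OF assms(1)] by blast
  then show ?thesis
    by (rule card_of_subset_le[OF _ card_of_subsets_le_Pow[OF assms]])
qed

text \<open>The set A is built in stages indexed by the successor cardinal of S; by regularity of that
  cardinal a subset of A of size at most that of S already lies in one of the stages.\<close>

lemma closing_off:
  fixes \<Phi> :: "'a set \<Rightarrow> 'a set" and S :: "'c set"
  assumes S: "infinite S" and \<Phi>: "\<And>E. |E| \<le>o |S| \<Longrightarrow> |\<Phi> E| \<le>o |Pow S|"
  shows "\<exists>A. |A| \<le>o |Pow S| \<and> (\<forall>E. E \<subseteq> A \<and> |E| \<le>o |S| \<longrightarrow> \<Phi> E \<subseteq> A)"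
proof -
  define r where "r = cardSuc |S|"
  have r: "Card_order r" unfolding r_def by (simp add: cardSuc_Card_order)
  have wo: "wo_rel r" using r by (simp only: card_order_on_def wo_rel_def)
  have inf: "infinite (Field r)" unfolding r_def
    using S cardSuc_finite[OF card_of_Card_order, of S] by (simp only: Field_card_of not_False_eq_True)
  \<comment> \<open>The stages are indexed by \<kappa>^+, and \<kappa>^+ \<le> 2^\<kappa> by Cantor,
    so there are not too many of them.\<close>
  have small_Field: "|Field r| \<le>o |Pow S|"
  proof (rule ordIso_ordLeq_trans)
    show "|Field r| =o r" by (rule card_of_Field_ordIso[OF r])
    show "r \<le>o |Pow S|"
      unfolding r_def by (intro cardSuc_least card_of_Card_order card_of_Pow)
  qed
  define step where "step A = A \<union> \<Union> (\<Phi> ` {E. E \<subseteq> A \<and> |E| \<le>o |S| })" for A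
  \<comment> \<open>Transfinite recursion without case distinction: stage i collects
    \<open>step\<close> of all strictly earlier stages, which covers zero, successor and limit
    indices at once.\<close>
  define H where "H f i = (\<Union>j \<in> underS r i. step (f j))" for f :: "'c set \<Rightarrow> 'a set" and i
  define As where "As = wo_rel.worec r H"
  have "wo_rel.adm_wo r H"
    unfolding wo_rel.adm_wo_def[OF wo] H_def
    by (intro allI impI SUP_cong arg_cong[of _ _ step]) simp_all
  then have As: "As i = (\<Union>j \<in> underS r i. step (As j))" for i
    using fun_cong[OF wo_rel.worec_fixpoint[OF wo], of H i] unfolding As_def H_def by simp
  have chain: "relChain r As"
    unfolding relChain_def
  proof (intro allI impI)
    fix i j assume "(i, j) \<in> r"
    then have "underS r i \<subseteq> underS r j"
      by (rule underS_incr[OF wo_rel.TRANS[OF wo] wo_rel.ANTISYM[OF wo]])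
    then show "As i \<subseteq> As j" by (subst (1 2) As) blast
  qed
  have step_small: "|step A| \<le>o |Pow S|" if "|A| \<le>o |Pow S|" for A
    unfolding step_def
  proof (rule card_of_Un_ordLeq_infinite)
    show "infinite (Pow S)" using S by simp
    show "|\<Union> (\<Phi> ` {E. E \<subseteq> A \<and> |E| \<le>o |S| })| \<le>o |Pow S|"
      by (intro card_of_UNION_ordLeq_infinite card_of_subsets_le_Pow ballI \<Phi>)
        (use S that in \<open>simp_all only: finite_Pow_iff mem_Collect_eq not_False_eq_True\<close>)
  qed fact
  have small: "|As i| \<le>o |Pow S|" for i
  proof (induction i rule: wo_rel.well_order_induct[OF wo])
    case (1 i)
    have "|underS r i| \<le>o |Pow S|"
      by (rule card_of_subset_le[OF _ small_Field]) (simp add: underS_Field subsetI)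
    moreover have "\<forall>j \<in> underS r i. |step (As j)| \<le>o |Pow S|"
      using 1 step_small unfolding underS_def by blast
    ultimately show ?case
      using S by (subst As) (intro card_of_UNION_ordLeq_infinite; simp only: finite_Pow_iff not_False_eq_True)
  qed
  show ?thesis
  proof (intro exI conjI allI impI)
    show "|\<Union>i \<in> Field r. As i| \<le>o |Pow S|"
      using S small small_Field
      by (intro card_of_UNION_ordLeq_infinite ballI; simp only: finite_Pow_iff not_False_eq_True)
    fix E assume "E \<subseteq> (\<Union>i \<in> Field r. As i) \<and> |E| \<le>o |S|"
    then have E: "E \<subseteq> (\<Union>i \<in> Field r. As i)" "|E| \<le>o |S|" by simp_all
    then obtain i where i: "i \<in> Field r" "E \<subseteq> As i"
      using cardSuc_UNION[OF card_of_Card_order, of S As E] S chain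
      unfolding r_def Field_card_of by blast
    \<comment> \<open>An infinite cardinal has no last element, so some stage j comes strictly after
      i and absorbs \<open>step (As i)\<close>.\<close>
    obtain j where j: "j \<in> Field r" "i \<in> underS r j"
      using infinite_Card_order_limit[OF r inf i(1)] unfolding underS_def by blast
    have "\<Phi> E \<subseteq> As j" using i j E(2) unfolding As[of j] step_def by blast
    then show "\<Phi> E \<subseteq> (\<Union>i \<in> Field r. As i)" using j by blast
  qed
qed

section \<open>Compact spaces\<close>

text \<open>The complement of \<open>W\<close> is compact and covered by the complements of the
  \<open>C i\<close>. The factor \<open>topspace Z\<close> gives the intersection its meaning when
  \<open>I\<close> or \<open>J\<close> is empty.\<close>

lemma compact_space_Inter_subset_open:
  assumes Z: "compact_space Z" and C: "\<And>i. i \<in> I \<Longrightarrow> closedin Z (C i)"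
    and W: "openin Z W" "topspace Z \<inter> (\<Inter>i\<in>I. C i) \<subseteq> W"
  obtains J where "finite J" "J \<subseteq> I" "topspace Z \<inter> (\<Inter>i\<in>J. C i) \<subseteq> W"
proof -
  have "closedin Z (topspace Z - W)" using W(1) by blast
  then have cpt: "compactin Z (topspace Z - W)" using Z closedin_compact_space by blast
  have op: "openin Z U" if "U \<in> (\<lambda>i. topspace Z - C i) ` I" for U
    using C that by blast
  have cov: "topspace Z - W \<subseteq> \<Union> ((\<lambda>i. topspace Z - C i) ` I)"
    using W(2) by blast
  obtain \<G> where \<G>: "finite \<G>" "\<G> \<subseteq> (\<lambda>i. topspace Z - C i) ` I" "topspace Z - W \<subseteq> \<Union>\<G>"
    using compactinD[OF cpt op cov] by blast
  obtain J where J: "J \<subseteq> I" "finite J" "\<G> = (\<lambda>i. topspace Z - C i) ` J"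
    using finite_subset_image[OF \<G>(1,2)] by blast
  have "topspace Z \<inter> (\<Inter>i\<in>J. C i) \<subseteq> W" using \<G>(3) J(3) by blast
  with J that show thesis by blast
qed

text \<open>Character equals pseudocharacter at a point of a compact Hausdorff space. Each
  \<open>U\<close> is shrunk to an open \<open>V U\<close> inside a closed \<open>C U\<close>; the
  sets \<open>C U\<close> meet only in x, so by compactness finitely many of them already fit into a
  given \<open>W\<close>. The base consists of the finite intersections of the \<open>V U\<close>,
  which an infinite \<open>S\<close> can still count.\<close>

lemma compact_Hausdorff_local_base:
  fixes S :: "'c set"
  assumes Z: "compact_space Z" "Hausdorff_space Z" and S: "infinite S"
    and psi: "\<exists>\<U>. (\<forall>U\<in>\<U>. openin Z U \<and> x \<in> U) \<and> topspace Z \<inter> \<Inter>\<U> = {x} \<and> |\<U>| \<le>o |S|"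
  shows "\<exists>\<B>. (\<forall>V\<in>\<B>. openin Z V \<and> x \<in> V) \<and>
    (\<forall>W. openin Z W \<and> x \<in> W \<longrightarrow> (\<exists>V\<in>\<B>. V \<subseteq> W)) \<and> |\<B>| \<le>o |S|"
proof -
  from psi obtain \<U> where \<U>: "\<forall>U\<in>\<U>. openin Z U \<and> x \<in> U"
    "topspace Z \<inter> \<Inter>\<U> = {x}" "|\<U>| \<le>o |S|"
    by (elim exE conjE)
  have x: "x \<in> topspace Z" using \<U>(2) by blast
  have "neighbourhood_base_of (closedin Z) Z"
    using Z neighbourhood_base_of_closedin compact_Hausdorff_imp_regular_space by blast
  then have "\<forall>U\<in>\<U>. \<exists>V C. openin Z V \<and> closedin Z C \<and> x \<in> V \<and> V \<subseteq> C \<and> C \<subseteq> U"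
    using \<U>(1) unfolding neighbourhood_base_of by blast
  then obtain V C where VC:
    "\<And>U. U \<in> \<U> \<Longrightarrow> openin Z (V U) \<and> closedin Z (C U) \<and> x \<in> V U \<and> V U \<subseteq> C U \<and> C U \<subseteq> U"
    by metis
  have closed_C: "\<And>U. U \<in> \<U> \<Longrightarrow> closedin Z (C U)" using VC by blast
  define \<B> where "\<B> = (\<lambda>F. topspace Z \<inter> (\<Inter>U\<in>F. V U)) ` Fpow \<U>"
  have "openin Z B \<and> x \<in> B" if B_in: "B \<in> \<B>" for B
  proof -
    obtain F where "F \<in> Fpow \<U>" and B: "B = topspace Z \<inter> (\<Inter>U\<in>F. V U)"
      using B_in unfolding \<B>_def by blast
    then have F: "finite F" "F \<subseteq> \<U>" by (simp_all add: Fpow_def)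
    have "openin Z (V U)" "x \<in> V U" if "U \<in> F" for U using VC F(2) that by blast+
    then show ?thesis using x openin_INT[OF F(1), of Z V] unfolding B by (simp add: Int_commute)
  qed
  moreover have "\<exists>B\<in>\<B>. B \<subseteq> W" if W: "openin Z W" "x \<in> W" for W
  proof -
    have "topspace Z \<inter> (\<Inter>U\<in>\<U>. C U) \<subseteq> topspace Z \<inter> \<Inter>\<U>" using VC by blast
    then have sub: "topspace Z \<inter> (\<Inter>U\<in>\<U>. C U) \<subseteq> W" 
      unfolding \<U>(2) by (rule subset_trans) (use W(2) in simp)
    obtain F where F: "finite F" "F \<subseteq> \<U>" "topspace Z \<inter> (\<Inter>U\<in>F. C U) \<subseteq> W"
      by (rule compact_space_Inter_subset_open[OF Z(1) closed_C W(1) sub])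
    have "topspace Z \<inter> (\<Inter>U\<in>F. V U) \<subseteq> topspace Z \<inter> (\<Inter>U\<in>F. C U)"
      by (intro Int_mono order_refl INF_superset_mono) (use VC F(2) in blast)
    then have "topspace Z \<inter> (\<Inter>U\<in>F. V U) \<subseteq> W" using F(3) by (rule subset_trans)
    moreover have "F \<in> Fpow \<U>" using F by (simp add: Fpow_def)
    ultimately show ?thesis unfolding \<B>_def by (rule bexI[OF _ imageI])
  qed
  moreover have "|\<B>| \<le>o |S|"
  proof -
    have "|Fpow \<U>| \<le>o |Fpow S|" by (rule card_of_Fpow_mono[OF \<U>(3)])
    then have "|Fpow \<U>| \<le>o |S|" by (rule ordLeq_ordIso_trans[OF _ card_of_Fpow_infinite[OF S]])
    then show ?thesis unfolding \<B>_def by (rule card_of_image_le)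
  qed
  ultimately show ?thesis by (intro exI[of _ \<B>] conjI ballI allI impI) simp_all
qed

section \<open>Arhangelskii's bound for compact Hausdorff spaces\<close>

lemma card_of_closure_le_Pow:
  fixes S :: "'c set"
  assumes Z: "Hausdorff_space Z" and S: "infinite S"
    and N_open: "\<And>x V. x \<in> topspace Z \<Longrightarrow> V \<in> N x \<Longrightarrow> openin Z V \<and> x \<in> V"
    and N_base: "\<And>x W. openin Z W \<Longrightarrow> x \<in> W \<Longrightarrow> \<exists>V\<in>N x. V \<subseteq> W"
    and N_card: "\<And>x. x \<in> topspace Z \<Longrightarrow> |N x| \<le>o |S|"
    and E: "|E| \<le>o |S|"
  shows "|Z closure_of E| \<le>o |Pow S|"
proof -
  \<comment> \<open>A point of the closure is determined by the traces on E of its basic neighbourhoods.\<close>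
  define tr where "tr z = (\<lambda>V. V \<inter> E) ` N z" for z
  have "inj_on tr (Z closure_of E)"
  proof (rule inj_onI, rule ccontr)
    fix y z assume y: "y \<in> Z closure_of E" and z: "z \<in> Z closure_of E"
      and eq: "tr y = tr z" and "y \<noteq> z"
    then obtain U V where UV: "openin Z U" "openin Z V" "y \<in> U" "z \<in> V" "disjnt U V"
      using Z unfolding Hausdorff_space_def in_closure_of by metis
    obtain U' where U': "U' \<in> N y" "U' \<subseteq> U" using N_base UV by blast
    then have "U' \<inter> E \<in> tr z" using eq unfolding tr_def by blast
    then obtain W where W: "W \<in> N z" "U' \<inter> E = W \<inter> E" unfolding tr_def by blast
    have "z \<in> topspace Z" using z in_closure_of by metis
    \<comment> \<open>A point of \<open>E\<close> in \<open>W \<inter> V\<close> has its trace in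
      \<open>U'\<close>, hence lies in \<open>U\<close>, which is disjoint from
      \<open>V\<close>.\<close>
    then have "openin Z (W \<inter> V)" "z \<in> W \<inter> V" using N_open W(1) UV by blast+
    then obtain e where "e \<in> E" "e \<in> W \<inter> V" using z unfolding in_closure_of by metis
    then show False using W(2) U' UV(5) unfolding disjnt_def by blast
  qed
  moreover have "tr ` (Z closure_of E) \<subseteq> {\<E>. \<E> \<subseteq> Pow E \<and> |\<E>| \<le>o |S| }"
  proof
    fix t assume "t \<in> tr ` (Z closure_of E)"
    then obtain z where "z \<in> Z closure_of E" and t: "t = tr z" by blast
    then have z: "z \<in> topspace Z" using closure_of_subset_topspace by fast
    have "|tr z| \<le>o |S|" unfolding tr_def by (rule card_of_image_le[OF N_card[OF z]])
    then show "t \<in> {\<E>. \<E> \<subseteq> Pow E \<and> |\<E>| \<le>o |S| }" unfolding t by (simp add: tr_def image_subset_iff)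
  qed
  ultimately have "|Z closure_of E| \<le>o |{\<E>. \<E> \<subseteq> Pow E \<and> |\<E>| \<le>o |S| }|"
    by (intro iffD1[OF card_of_ordLeq] exI[of _ tr] conjI)
  also have "|{\<E>. \<E> \<subseteq> Pow E \<and> |\<E>| \<le>o |S| }| \<le>o |Pow S|"
    by (intro card_of_subsets_le_Pow S card_of_Pow_mono E)
  finally show ?thesis .
qed

text \<open>A set \<open>A\<close> of size at most 2^\<kappa> is closed off so that it contains the
  closure of each of its small subsets and, for every family of basic neighbourhoods of few of its
  points that does not cover Z, a point outside that family. The first property makes
  \<open>A'\<close> closed, hence compact. If some q were missing, finitely many basic
  neighbourhoods avoiding q would cover \<open>A'\<close>, and the second property would put into
  \<open>A'\<close> a point outside this cover.\<close>

theorem Arhangelskii_compact: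
  fixes S :: "'c set"
  assumes Z: "compact_space Z" "Hausdorff_space Z" and S: "infinite S"
    and psi: "\<And>x. x \<in> topspace Z \<Longrightarrow>
      \<exists>\<U>. (\<forall>U\<in>\<U>. openin Z U \<and> x \<in> U) \<and> topspace Z \<inter> \<Inter>\<U> = {x} \<and> |\<U>| \<le>o |S|"
  shows "|topspace Z| \<le>o |Pow S|"
proof -
  have "\<forall>x\<in>topspace Z. \<exists>\<B>. (\<forall>V\<in>\<B>. openin Z V \<and> x \<in> V) \<and>
      (\<forall>W. openin Z W \<and> x \<in> W \<longrightarrow> (\<exists>V\<in>\<B>. V \<subseteq> W)) \<and> |\<B>| \<le>o |S|"
    by (intro ballI compact_Hausdorff_local_base[OF Z S psi])
  from bchoice[OF this] obtain N where N: "\<forall>x\<in>topspace Z. (\<forall>V\<in>N x. openin Z V \<and> x \<in> V) \<and>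
      (\<forall>W. openin Z W \<and> x \<in> W \<longrightarrow> (\<exists>V\<in>N x. V \<subseteq> W)) \<and> |N x| \<le>o |S|" ..
  have N_open: "\<And>x V. x \<in> topspace Z \<Longrightarrow> V \<in> N x \<Longrightarrow> openin Z V \<and> x \<in> V"
    and N_card: "\<And>x. x \<in> topspace Z \<Longrightarrow> |N x| \<le>o |S|"
    using N by metis+
  have N_base: "\<And>x W. openin Z W \<Longrightarrow> x \<in> W \<Longrightarrow> \<exists>V\<in>N x. V \<subseteq> W"
    using N openin_subset by (metis subsetD)
  \<comment> \<open>If \<W> covers Z, this choice is arbitrary and may fall outside Z; hence the
    intersections with \<open>topspace Z\<close> in \<open>nb\<close> and \<open>A'\<close>.\<close>
  define pt where "pt \<W> = (SOME p. p \<in> topspace Z - \<Union>\<W>)" for \<W>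
  define nb where "nb E = (\<Union>x \<in> E \<inter> topspace Z. N x)" for E
  define \<Phi> where "\<Phi> E = Z closure_of E \<union> pt ` Pow (nb E)" for E
  have \<Phi>_card: "|\<Phi> E| \<le>o |Pow S|" if E: "|E| \<le>o |S|" for E
    unfolding \<Phi>_def
  proof (rule card_of_Un_ordLeq_infinite)
    show "infinite (Pow S)" using S by simp
    show "|Z closure_of E| \<le>o |Pow S|"
      by (rule card_of_closure_le_Pow[OF Z(2) S N_open N_base N_card E])
    have "|nb E| \<le>o |S|"
      unfolding nb_def
      by (intro card_of_UNION_ordLeq_infinite S card_of_subset_le[OF Int_lower1 E] ballI N_card) simp
    then show "|pt ` Pow (nb E)| \<le>o |Pow S|" by (intro card_of_image_le card_of_Pow_mono)
  qed
  have "\<exists>A. |A| \<le>o |Pow S| \<and> (\<forall>E. E \<subseteq> A \<and> |E| \<le>o |S| \<longrightarrow> \<Phi> E \<subseteq> A)"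
    by (rule closing_off[OF S]) (rule \<Phi>_card)
  then obtain A where A_card: "|A| \<le>o |Pow S|"
    and A_closed: "\<forall>E. E \<subseteq> A \<and> |E| \<le>o |S| \<longrightarrow> \<Phi> E \<subseteq> A"
    by (elim exE conjE)
  note A = A_card A_closed[rule_format, OF conjI]
  define A' where "A' = A \<inter> topspace Z"
  have "Z closure_of A' \<subseteq> A'"
  proof
    fix z assume z: "z \<in> Z closure_of A'"
    then have zZ: "z \<in> topspace Z" unfolding in_closure_of by blast
    \<comment> \<open>One point of \<open>A'\<close> from each basic neighbourhood of z gives a
      small subset of \<open>A\<close> that still has z in its closure.\<close>
    have "\<forall>V\<in>N z. \<exists>a. a \<in> A' \<and> a \<in> V"
      using z N_open[OF zZ] unfolding in_closure_of by blast
    then obtain a where a: "\<And>V. V \<in> N z \<Longrightarrow> a V \<in> A' \<and> a V \<in> V" by metis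
    have E: "a ` N z \<subseteq> A" using a unfolding A'_def by blast
    have E_card: "|a ` N z| \<le>o |S|" by (rule card_of_image_le[OF N_card[OF zZ]])
    have "\<exists>y\<in>a ` N z. y \<in> W" if "z \<in> W" "openin Z W" for W
      using N_base[OF that(2,1)] a by blast
    then have "z \<in> Z closure_of (a ` N z)" using zZ unfolding in_closure_of by blast
    then show "z \<in> A'" using A(2)[OF E E_card] zZ unfolding \<Phi>_def A'_def by blast
  qed
  then have "closedin Z A'"
    using closure_of_subset_eq[of A' Z] A'_def by blast
  then have cpt: "compactin Z A'" using Z(1) closedin_compact_space by blast
  have "topspace Z \<subseteq> A"
  proof
    fix q assume q: "q \<in> topspace Z"
    show "q \<in> A"
    proof (rule ccontr)
      assume "q \<notin> A"
      have "\<exists>U. U \<in> N x \<and> q \<notin> U" if "x \<in> A'" for x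
      proof -
        have "x \<noteq> q" "x \<in> topspace Z" using that \<open>q \<notin> A\<close> unfolding A'_def by blast+
        then obtain U V where "openin Z U" "openin Z V" "x \<in> U" "q \<in> V" "disjnt U V"
          using Z(2) q unfolding Hausdorff_space_def by metis
        then show ?thesis using N_base[of U x] unfolding disjnt_def by blast
      qed
      then obtain U where U: "\<And>x. x \<in> A' \<Longrightarrow> U x \<in> N x \<and> q \<notin> U x" by metis
      have UZ: "openin Z (U x) \<and> x \<in> U x" if "x \<in> A'" for x
        using N_open[of x "U x"] U[OF that] that unfolding A'_def by blast
      have op: "openin Z W" if "W \<in> U ` A'" for W using UZ that by blast
      have cov: "A' \<subseteq> \<Union> (U ` A')" using UZ by blast
      obtain \<G> where \<G>: "finite \<G>" "\<G> \<subseteq> U ` A'" "A' \<subseteq> \<Union>\<G>"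
        using compactinD[OF cpt op cov] by blast
      obtain E where E: "E \<subseteq> A'" "finite E" "\<G> = U ` E"
        using finite_subset_image[OF \<G>(1,2)] by blast
      have E': "E \<subseteq> A" using E(1) unfolding A'_def by blast
      have E_card: "|E| \<le>o |S|"
        by (rule countable_card_of_le_infinite[OF S countable_finite[OF E(2)]])
      have "\<G> \<in> Pow (nb E)" using E U unfolding nb_def A'_def by blast
      then have "pt \<G> \<in> A" using A(2)[OF E' E_card] unfolding \<Phi>_def by blast
      moreover have "q \<in> topspace Z - \<Union>\<G>" using q E U by blast
      then have "pt \<G> \<in> topspace Z - \<Union>\<G>" unfolding pt_def by (rule someI)
      ultimately show False using \<G>(3) unfolding A'_def by blast
    qed
  qed
  then show ?thesis using A(1) by (rule card_of_subset_le)
qed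

section \<open>Lindelof Sigma-spaces\<close>

text \<open>The network consists of the traces on Y of finite intersections from the separating
  family \<F> of the compactification. For a point y, the members of \<F> containing
  \<open>e y\<close> intersect in a closed, hence compact, set that the separation property keeps
  inside the image of Y. By compactness of K finitely many of them already lie in any open set
  around that intersection.\<close>

lemma lindelof_sigma_network:
  assumes "lindelof_sigma Y"
  shows "\<exists>\<N>. countable \<N> \<and> (\<forall>y\<in>topspace Y.
    compactin Y (topspace Y \<inter> \<Inter>{F \<in> \<N>. y \<in> F}) \<and>
    (\<forall>W. openin Y W \<and> topspace Y \<inter> \<Inter>{F \<in> \<N>. y \<in> F} \<subseteq> W \<longrightarrow>
      (\<exists>F\<in>\<N>. topspace Y \<inter> \<Inter>{F \<in> \<N>. y \<in> F} \<subseteq> F \<and> F \<subseteq> W)))"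
proof -
  obtain K :: "'a set set topology" and e \<F> where sc: "stone_cech Y K e"
    and \<F>: "countable \<F>" "\<And>F. F \<in> \<F> \<Longrightarrow> closedin K F"
    and sep: "\<And>y z. y \<in> topspace Y \<Longrightarrow> z \<in> topspace K - e ` topspace Y \<Longrightarrow>
      \<exists>F\<in>\<F>. e y \<in> F \<and> z \<notin> F"
    using assms unfolding lindelof_sigma_def by (elim exE conjE) metis
  have K: "compact_space K" using sc unfolding stone_cech_def by blast
  have hom: "homeomorphic_map Y (subtopology K (e ` topspace Y)) e"
    using sc unfolding stone_cech_def embedding_map_def by blast
  have inj: "inj_on e (topspace Y)" by (rule homeomorphic_imp_injective_map[OF hom])
  have eK: "e y \<in> topspace K" if "y \<in> topspace Y" for y
    using homeomorphic_imp_surjective_map[OF hom] that by auto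
  \<comment> \<open>\<open>p J\<close> is the preimage of the intersection of \<open>J\<close>; for
    empty \<open>J\<close> it is all of Y.\<close>
  define p where "p J = {x \<in> topspace Y. \<forall>F\<in>J. e x \<in> F}" for J
  define \<N> where "\<N> = p ` {J. J \<subseteq> \<F> \<and> finite J}"
  have cnt: "countable \<N>"
    unfolding \<N>_def using countable_Collect_finite_subset[OF \<F>(1)] by (simp add: conj_commute)
  define I where "I y = {F \<in> \<F>. e y \<in> F}" for y
  have C_eq: "topspace Y \<inter> \<Inter>{F \<in> \<N>. y \<in> F} = p (I y)" if "y \<in> topspace Y" for y
  proof
    show "topspace Y \<inter> \<Inter>{F \<in> \<N>. y \<in> F} \<subseteq> p (I y)"
    proof
      fix x assume x: "x \<in> topspace Y \<inter> \<Inter>{F \<in> \<N>. y \<in> F}"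
      have "e x \<in> F" if F: "F \<in> I y" for F
      proof -
        have "p {F} \<in> \<N>" "y \<in> p {F}"
          using F \<open>y \<in> topspace Y\<close> unfolding \<N>_def I_def by (auto simp: p_def)
        then show ?thesis using x unfolding p_def by blast
      qed
      then show "x \<in> p (I y)" using x unfolding p_def by blast
    qed
    show "p (I y) \<subseteq> topspace Y \<inter> \<Inter>{F \<in> \<N>. y \<in> F}"
      unfolding \<N>_def p_def I_def by auto
  qed
  have image_C: "e ` p (I y) = topspace K \<inter> \<Inter>(I y)" if "y \<in> topspace Y" for y
  proof
    show "e ` p (I y) \<subseteq> topspace K \<inter> \<Inter>(I y)" using eK unfolding p_def by blast
    show "topspace K \<inter> \<Inter>(I y) \<subseteq> e ` p (I y)"
    proof
      fix z assume z: "z \<in> topspace K \<inter> \<Inter>(I y)"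
      \<comment> \<open>A point z outside the image of Y would be excluded by some F of \<F> that
        contains \<open>e y\<close>.\<close>
      then have "z \<in> e ` topspace Y" using sep[OF that, of z] unfolding I_def by blast
      then show "z \<in> e ` p (I y)" using z unfolding p_def by blast
    qed
  qed
  have "compactin Y (topspace Y \<inter> \<Inter>{F \<in> \<N>. y \<in> F})" if y: "y \<in> topspace Y" for y
  proof -
    have "closedin K (topspace K \<inter> \<Inter>(I y))"
    proof (cases "I y = {}")
      case False
      then show ?thesis using \<F>(2) unfolding I_def by (intro closedin_Int closedin_Inter) auto
    qed simp
    then have "compactin K (e ` p (I y))"
      unfolding image_C[OF y] using K closedin_compact_space by blast
    moreover have "p (I y) \<subseteq> topspace Y" unfolding p_def by blast
    ultimately have "compactin Y (p (I y))"
      using homeomorphic_map_compactness_eq[OF hom] by (auto simp: compactin_subtopology)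
    then show ?thesis unfolding C_eq[OF y] .
  qed
  moreover have "\<exists>F\<in>\<N>. topspace Y \<inter> \<Inter>{F \<in> \<N>. y \<in> F} \<subseteq> F \<and> F \<subseteq> W"
    if y: "y \<in> topspace Y" and W: "openin Y W" and sub: "topspace Y \<inter> \<Inter>{F \<in> \<N>. y \<in> F} \<subseteq> W"
    for y W
  proof -
    have "openin (subtopology K (e ` topspace Y)) (e ` W)"
      using homeomorphic_imp_open_map[OF hom] W unfolding open_map_def by blast
    then obtain Q where Q: "openin K Q" "e ` W = Q \<inter> e ` topspace Y"
      unfolding openin_subtopology by blast
    have clo: "\<And>F. F \<in> I y \<Longrightarrow> closedin K F" using \<F>(2) unfolding I_def by blast
    have "e ` p (I y) \<subseteq> Q" using sub Q(2) unfolding C_eq[OF y] by blast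
    then have subQ: "topspace K \<inter> (\<Inter>F\<in>I y. F) \<subseteq> Q" unfolding image_C[OF y] by simp
    obtain J where J: "finite J" "J \<subseteq> I y" "topspace K \<inter> (\<Inter>F\<in>J. F) \<subseteq> Q"
      by (rule compact_space_Inter_subset_open[OF K clo Q(1) subQ])
    have "p J \<subseteq> W"
    proof
      fix x assume x: "x \<in> p J"
      then have xY: "x \<in> topspace Y" unfolding p_def by blast
      then have "e x \<in> Q" using x J(3) eK unfolding p_def by blast
      then obtain w where w: "w \<in> W" "e x = e w" using Q(2) xY by blast
      then have "w \<in> topspace Y" using openin_subset[OF W] by blast
      then show "x \<in> W" using inj_onD[OF inj w(2) xY] w(1) by blast
    qed
    moreover have "p (I y) \<subseteq> p J" using J(2) unfolding p_def by blast
    moreover have "p J \<in> \<N>" using J(1,2) unfolding \<N>_def I_def by blast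
    ultimately show ?thesis unfolding C_eq[OF y] by blast
  qed
  ultimately show ?thesis using cnt by (intro exI[of _ \<N>] conjI ballI allI impI) simp_all
qed

text \<open>The compact pieces are intersections of subfamilies of one countable family, which is
  why there are at most 2^\<omega> \<le> 2^\<kappa> of them. Pseudocharacter passes to each piece by
  tracing, so each has at most 2^\<kappa> points.\<close>

lemma lindelof_sigma_card_le_Pow:
  fixes S :: "'c set"
  assumes Y: "lindelof_sigma Y" and S: "infinite S"
    and psi: "\<And>x. x \<in> topspace Y \<Longrightarrow>
      \<exists>\<U>. (\<forall>U\<in>\<U>. openin Y U \<and> x \<in> U) \<and> \<Inter>\<U> = {x} \<and> |\<U>| \<le>o |S|"
  shows "|topspace Y| \<le>o |Pow S|"
proof -
  from lindelof_sigma_network[OF Y] obtain \<N> where cnt: "countable \<N>"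
    and cpt: "\<And>y. y \<in> topspace Y \<Longrightarrow> compactin Y (topspace Y \<inter> \<Inter>{F \<in> \<N>. y \<in> F})"
    by blast
  have inf: "infinite (Pow S)" using S by simp
  have haus: "Hausdorff_space Y"
    using Y unfolding lindelof_sigma_def tychonoff_space_def by blast
  have compact_small: "|C| \<le>o |Pow S|" if C: "compactin Y C" for C
  proof -
    have CY: "C \<subseteq> topspace Y" using C compactin_subset_topspace by blast
    have top: "topspace (subtopology Y C) = C" using CY by auto
    have "|topspace (subtopology Y C)| \<le>o |Pow S|"
    proof (rule Arhangelskii_compact[OF _ _ S])
      show "compact_space (subtopology Y C)" using C compactin_subspace by blast
      show "Hausdorff_space (subtopology Y C)" using haus Hausdorff_space_subtopology by blast
      fix x assume "x \<in> topspace (subtopology Y C)"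
      then have x: "x \<in> C" using top by blast
      then have "x \<in> topspace Y" using CY by blast
      from psi[OF this] obtain \<U> where \<U>: "\<forall>U\<in>\<U>. openin Y U \<and> x \<in> U"
        "\<Inter>\<U> = {x}" "|\<U>| \<le>o |S|" by (elim exE conjE)
      show "\<exists>\<U>. (\<forall>U\<in>\<U>. openin (subtopology Y C) U \<and> x \<in> U) \<and>
          topspace (subtopology Y C) \<inter> \<Inter>\<U> = {x} \<and> |\<U>| \<le>o |S|"
      proof (intro exI conjI)
        show "\<forall>U\<in>(\<lambda>U. U \<inter> C) ` \<U>. openin (subtopology Y C) U \<and> x \<in> U"
          using \<U>(1) x by (auto intro: openin_subtopology_Int)
        show "topspace (subtopology Y C) \<inter> \<Inter>((\<lambda>U. U \<inter> C) ` \<U>) = {x}"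
          unfolding top using \<U>(2) x by auto
        show "|(\<lambda>U. U \<inter> C) ` \<U>| \<le>o |S|" by (rule card_of_image_le[OF \<U>(3)])
      qed
    qed
    then show ?thesis unfolding top .
  qed
  define \<E> where "\<E> = {E. (E \<subseteq> \<N> \<and> countable E) \<and> compactin Y (topspace Y \<inter> \<Inter>E)}"
  have "|\<E>| \<le>o |Pow S|"
  proof (rule card_of_subset_le)
    show "\<E> \<subseteq> {E. E \<subseteq> \<N> \<and> countable E}" unfolding \<E>_def by blast
    show "|{E. E \<subseteq> \<N> \<and> countable E}| \<le>o |Pow S|"
      by (intro card_of_countable_subsets_le_Pow S countable_card_of_le_infinite inf cnt)
  qed
  then have "|\<Union>E\<in>\<E>. topspace Y \<inter> \<Inter>E| \<le>o |Pow S|"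
    by (intro card_of_UNION_ordLeq_infinite inf ballI compact_small) (simp_all add: \<E>_def)
  moreover have "topspace Y \<subseteq> (\<Union>E\<in>\<E>. topspace Y \<inter> \<Inter>E)"
  proof
    fix y assume y: "y \<in> topspace Y"
    have "{F \<in> \<N>. y \<in> F} \<in> \<E>"
      unfolding \<E>_def using cpt[OF y] countable_subset[OF _ cnt, of "{F \<in> \<N>. y \<in> F}"] by auto
    then show "y \<in> (\<Union>E\<in>\<E>. topspace Y \<inter> \<Inter>E)" using y by blast
  qed
  ultimately show ?thesis by (rule card_of_subset_le[rotated])
qed

text \<open>The compact cover stays implicit, each point having a K of its own, so that the only
  family to be counted is \<N>. The sets U are open in the ambient space T rather than in D, so
  continuity, products and closures can all be handled in T; members of \<N> are arbitrary
  sets.\<close>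

definition compact_network :: "'a topology \<Rightarrow> 'a set \<Rightarrow> 'a set set \<Rightarrow> bool" where
  "compact_network T D \<N> \<longleftrightarrow> (\<forall>d\<in>D. \<exists>K. d \<in> K \<and> compactin T K \<and> K \<subseteq> D \<and>
     (\<forall>U. openin T U \<and> K \<subseteq> U \<longrightarrow> (\<exists>F\<in>\<N>. K \<subseteq> F \<and> F \<subseteq> U)))"

lemma lindelof_sigma_compact_network:
  assumes "lindelof_sigma (subtopology T X)" "X \<subseteq> topspace T"
  obtains \<N> where "countable \<N>" "compact_network T X \<N>"
proof -
  let ?Y = "subtopology T X"
  have top: "topspace ?Y = X" using assms(2) by auto
  from lindelof_sigma_network[OF assms(1)] obtain \<N> where \<N>: "countable \<N>"
    and net: "\<forall>y\<in>X. compactin ?Y (X \<inter> \<Inter>{F \<in> \<N>. y \<in> F}) \<and>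
      (\<forall>W. openin ?Y W \<and> X \<inter> \<Inter>{F \<in> \<N>. y \<in> F} \<subseteq> W \<longrightarrow>
        (\<exists>F\<in>\<N>. X \<inter> \<Inter>{F \<in> \<N>. y \<in> F} \<subseteq> F \<and> F \<subseteq> W))"
    unfolding top by (elim exE conjE)
  have "compact_network T X \<N>"
    unfolding compact_network_def
  proof
    fix d assume d: "d \<in> X"
    define K where "K = X \<inter> \<Inter>{F \<in> \<N>. d \<in> F}"
    have dK: "d \<in> K" using d unfolding K_def by blast
    have KX: "K \<subseteq> X" unfolding K_def by blast
    from net d have "compactin ?Y K" and K_net: "\<And>W. openin ?Y W \<Longrightarrow> K \<subseteq> W \<Longrightarrow> \<exists>F\<in>\<N>. K \<subseteq> F \<and> F \<subseteq> W"
      unfolding K_def by simp_all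
    then have Kc: "compactin T K" by (simp add: compactin_subtopology)
    have "\<exists>F\<in>\<N>. K \<subseteq> F \<and> F \<subseteq> U" if U: "openin T U" "K \<subseteq> U" for U
    proof -
      have "openin ?Y (U \<inter> X)" by (rule openin_subtopology_Int[OF U(1)])
      then show ?thesis using K_net[of "U \<inter> X"] U(2) KX by blast
    qed
    with dK Kc KX show "\<exists>K. d \<in> K \<and> compactin T K \<and> K \<subseteq> X \<and>
     (\<forall>U. openin T U \<and> K \<subseteq> U \<longrightarrow> (\<exists>F\<in>\<N>. K \<subseteq> F \<and> F \<subseteq> U))" by blast
  qed
  with \<N> show thesis by (rule that)
qed

section \<open>Weight of regular spaces\<close>

lemma Hausdorff_separated_from_closure:
  assumes "Hausdorff_space T" "x \<in> topspace T" "y \<in> topspace T" "x \<noteq> y"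
  obtains U where "openin T U" "x \<in> U" "y \<notin> T closure_of U"
proof -
  obtain U V where UV: "openin T U" "openin T V" "x \<in> U" "y \<in> V" "disjnt U V"
    using assms unfolding Hausdorff_space_def by metis
  have "y \<notin> T closure_of U" using UV(2,4,5) unfolding in_closure_of disjnt_def by blast
  with UV(1,3) show thesis by (rule that)
qed

text \<open>This is the proof that disjoint closed subsets of a compact Hausdorff space can be
  separated, with a record of the sets used: the separating set is a finite union of finite
  intersections from \<B>, so that such sets can be counted. The closure is taken in all of T, as
  density arguments in T require.\<close>

lemma compact_separation:
  assumes K: "compactin T K" and P: "closedin T P" and Q: "closedin T Q" and PQ: "P \<inter> Q = {}"
    and sep: "\<forall>x\<in>K. \<forall>y\<in>K. x \<noteq> y \<longrightarrow>
      b x y \<in> \<B> \<and> openin T (b x y) \<and> x \<in> b x y \<and> y \<notin> T closure_of b x y"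
  shows "\<exists>\<G>. finite \<G> \<and> (\<forall>\<H>\<in>\<G>. finite \<H> \<and> \<H> \<subseteq> \<B>) \<and>
    (\<forall>\<H>\<in>\<G>. openin T (topspace T \<inter> \<Inter>\<H>)) \<and>
    K \<inter> P \<subseteq> (\<Union>\<H>\<in>\<G>. topspace T \<inter> \<Inter>\<H>) \<and>
    K \<inter> Q \<inter> T closure_of (\<Union>\<H>\<in>\<G>. topspace T \<inter> \<Inter>\<H>) = {}"
proof -
  have KT: "K \<subseteq> topspace T" using K compactin_subset_topspace by blast
  have "\<exists>\<H>. finite \<H> \<and> \<H> \<subseteq> \<B> \<and> openin T (topspace T \<inter> \<Inter>\<H>) \<and> x \<in> topspace T \<inter> \<Inter>\<H> \<and>
      K \<inter> Q \<inter> T closure_of (topspace T \<inter> \<Inter>\<H>) = {}" if x: "x \<in> K \<inter> P" for x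
  proof -
    have cpt: "compactin T (K \<inter> Q)" by (rule compact_Int_closedin[OF K Q])
    have b: "b x y \<in> \<B>" "openin T (b x y)" "x \<in> b x y" "y \<notin> T closure_of b x y"
      if y: "y \<in> K \<inter> Q" for y
    proof -
      have "x \<noteq> y" using x y PQ by blast
      then show "b x y \<in> \<B>" "openin T (b x y)" "x \<in> b x y" "y \<notin> T closure_of b x y"
        using sep x y by simp_all
    qed
    have op: "openin T W" if "W \<in> (\<lambda>y. topspace T - T closure_of b x y) ` (K \<inter> Q)" for W
      using that closedin_closure_of by blast
    \<comment> \<open>For fixed x, the complements of the closures of the \<open>b x y\<close> cover
      the compact set \<open>K \<inter> Q\<close>; a finite subcover names the factors of the
      intersection.\<close>
    have cov: "K \<inter> Q \<subseteq> \<Union> ((\<lambda>y. topspace T - T closure_of b x y) ` (K \<inter> Q))"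
      using b(4) KT by blast
    obtain \<W> where \<W>: "finite \<W>" "\<W> \<subseteq> (\<lambda>y. topspace T - T closure_of b x y) ` (K \<inter> Q)"
      "K \<inter> Q \<subseteq> \<Union>\<W>"
      using compactinD[OF cpt op cov] by blast
    obtain J where J: "J \<subseteq> K \<inter> Q" "finite J" "\<W> = (\<lambda>y. topspace T - T closure_of b x y) ` J"
      using finite_subset_image[OF \<W>(1,2)] by blast
    have "openin T ((\<Inter>y\<in>J. b x y) \<inter> topspace T)"
      by (rule openin_INT[OF J(2)]) (use b(2) J(1) in blast)
    moreover have "K \<inter> Q \<inter> T closure_of (topspace T \<inter> \<Inter> (b x ` J)) = {}"
    proof -
      have "T closure_of (topspace T \<inter> \<Inter> (b x ` J)) \<subseteq> T closure_of b x y" if "y \<in> J" for y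
        by (rule closure_of_mono) (use that in blast)
      then show ?thesis using \<W>(3) unfolding J(3) by blast
    qed
    moreover have "b x ` J \<subseteq> \<B>" "x \<in> topspace T \<inter> \<Inter> (b x ` J)" using b(1,3) J(1) x KT by blast+
    ultimately show ?thesis
      using J(2) by (intro exI[of _ "b x ` J"]) (simp add: Int_commute)
  qed
  then have "\<forall>x\<in>K \<inter> P. \<exists>\<H>. finite \<H> \<and> \<H> \<subseteq> \<B> \<and> openin T (topspace T \<inter> \<Inter>\<H>) \<and>
      x \<in> topspace T \<inter> \<Inter>\<H> \<and> K \<inter> Q \<inter> T closure_of (topspace T \<inter> \<Inter>\<H>) = {}" by (rule ballI)
  from bchoice[OF this] obtain H where H: "\<forall>x\<in>K \<inter> P. finite (H x) \<and> H x \<subseteq> \<B> \<and>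
      openin T (topspace T \<inter> \<Inter>(H x)) \<and>
      x \<in> topspace T \<inter> \<Inter>(H x) \<and> K \<inter> Q \<inter> T closure_of (topspace T \<inter> \<Inter>(H x)) = {}" ..
  have cpt: "compactin T (K \<inter> P)" by (rule compact_Int_closedin[OF K P])
  have op: "openin T W" if "W \<in> (\<lambda>x. topspace T \<inter> \<Inter>(H x)) ` (K \<inter> P)" for W
    using H that by blast
  have cov: "K \<inter> P \<subseteq> \<Union> ((\<lambda>x. topspace T \<inter> \<Inter>(H x)) ` (K \<inter> P))" using H by blast
  obtain \<W> where \<W>: "finite \<W>" "\<W> \<subseteq> (\<lambda>x. topspace T \<inter> \<Inter>(H x)) ` (K \<inter> P)" "K \<inter> P \<subseteq> \<Union>\<W>"
    using compactinD[OF cpt op cov] by blast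
  obtain J where J: "J \<subseteq> K \<inter> P" "finite J" "\<W> = (\<lambda>x. topspace T \<inter> \<Inter>(H x)) ` J"
    using finite_subset_image[OF \<W>(1,2)] by blast
  \<comment> \<open>Finiteness of \<W> matters: closure commutes with finite unions, so the union
    still has closure missing \<open>K \<inter> Q\<close>.\<close>
  have "T closure_of \<Union>\<W> = (\<Union>W\<in>\<W>. T closure_of W)" by (rule closure_of_Union[OF \<W>(1)])
  then have disj: "K \<inter> Q \<inter> T closure_of \<Union>\<W> = {}" using H J(1) unfolding J(3) by blast
  have eq: "(\<Union>\<H>\<in>H ` J. topspace T \<inter> \<Inter>\<H>) = \<Union>\<W>" unfolding J(3) by blast
  show ?thesis
  proof (intro exI[of _ "H ` J"] conjI)
    show "finite (H ` J)" using J(2) by simp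
    show "\<forall>\<H>\<in>H ` J. finite \<H> \<and> \<H> \<subseteq> \<B>" using H J(1) by blast
    show "\<forall>\<H>\<in>H ` J. openin T (topspace T \<inter> \<Inter>\<H>)" using H J(1) by blast
  qed (unfold eq, fact \<W>(3), fact disj)
qed

text \<open>Given p in U, regularity and density reduce the task to a set E of permitted pieces
  whose union contains \<open>D\<close> near p and stays well inside U. The pieces come from a
  family fixed in advance, independent of p and U, which bounds the size of the base.\<close>

lemma weight_le_Pow_of_dense_compact_network:
  fixes S :: "'c set" and T :: "'a topology"
  assumes S: "infinite S" and reg: "regular_space T" and haus: "Hausdorff_space T"
    and D: "D \<subseteq> topspace T" "T closure_of D = topspace T" "|D| \<le>o |Pow S|"
    and \<N>: "countable \<N>" "compact_network T D \<N>"
  shows "\<exists>B. is_base T B \<and> |B| \<le>o |Pow S|"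
proof -
  have inf: "infinite (Pow S)" using S by simp
  have "\<exists>U. openin T U \<and> x \<in> U \<and> y \<notin> T closure_of U" if "x \<in> D" "y \<in> D" "x \<noteq> y" for x y
    using Hausdorff_separated_from_closure[OF haus, of x y] that D(1) by blast
  then obtain b where b: "\<And>x y. x \<in> D \<Longrightarrow> y \<in> D \<Longrightarrow> x \<noteq> y \<Longrightarrow>
      openin T (b x y) \<and> x \<in> b x y \<and> y \<notin> T closure_of b x y"
    by metis
  define ctbl where "ctbl \<A> = {E. E \<subseteq> \<A> \<and> countable E}" for \<A> :: "'a set set"
  have ctbl_card: "|ctbl \<A>| \<le>o |Pow S|" if "|\<A>| \<le>o |Pow S|" for \<A>
    unfolding ctbl_def by (rule card_of_countable_subsets_le_Pow[OF S that])
  \<comment> \<open>Countable intersections and unions are allowed although finite ones will occur,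
    because one count then covers every level. Members of these families need not be open:
    \<open>b\<close> is arbitrary on the diagonal, and intersections may be infinite. Openness is
    obtained from \<open>compact_separation\<close> for the sets actually found.\<close>
  define \<B>0 where "\<B>0 = (\<lambda>(x, y). b x y) ` (D \<times> D)"
  define \<B>1 where "\<B>1 = (\<lambda>E. topspace T \<inter> \<Inter>E) ` ctbl \<B>0"
  define \<B>2 where "\<B>2 = Union ` ctbl \<B>1"
  define \<A> where "\<A> = (\<lambda>(F, B). F \<inter> B) ` (\<N> \<times> \<B>2)"
  define \<B> where "\<B> = (\<lambda>E. T interior_of (T closure_of (D \<inter> \<Union>E))) ` ctbl \<A>"
  have "|\<B>| \<le>o |Pow S|"
    unfolding \<B>_def \<A>_def \<B>2_def \<B>1_def \<B>0_def
    by (intro card_of_image_le ctbl_card card_of_Times_ordLeq_infinite inf D(3)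
        countable_card_of_le_infinite \<N>(1))
  moreover have "is_base T \<B>"
    unfolding is_base_def
  proof (intro conjI ballI allI impI)
    show "openin T V" if "V \<in> \<B>" for V using that unfolding \<B>_def by auto
    fix U p assume "openin T U \<and> p \<in> U"
    then have U: "openin T U" "p \<in> U" by blast+
    have nb: "\<exists>V C. openin T V \<and> closedin T C \<and> p \<in> V \<and> V \<subseteq> C \<and> C \<subseteq> W" if "openin T W" "p \<in> W" for W
      using reg that unfolding neighbourhood_base_of_closedin[symmetric] neighbourhood_base_of by blast
    \<comment> \<open>Regularity is used twice, giving V \<subseteq> C \<subseteq> U' \<subseteq> C'
      \<subseteq> U. The inner gap separates C from the complement of U' on \<open>D\<close>; the
      outer one keeps a closure inside U.\<close>
    obtain U' C' where U': "openin T U'" "closedin T C'" "p \<in> U'" "U' \<subseteq> C'" "C' \<subseteq> U"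
      using nb[OF U] by blast
    obtain V C where V: "openin T V" "closedin T C" "p \<in> V" "V \<subseteq> C" "C \<subseteq> U'"
      using nb[OF U'(1,3)] by blast
    \<comment> \<open>The condition mentions F but not the compact set that led to it, so one B
      chosen for F serves every compact set lying in F.\<close>
    define ok where "ok F B \<longleftrightarrow> B \<in> \<B>2 \<and> F \<inter> C \<subseteq> B \<and> F \<inter> B \<subseteq> U'" for F B
    define sel where "sel F = (SOME B. ok F B)" for F
    \<comment> \<open>One member of E for each F keeps E countable.\<close>
    define E where "E = (\<lambda>F. F \<inter> sel F) ` {F \<in> \<N>. \<exists>B. ok F B}"
    have sel: "ok F (sel F)" if "\<exists>B. ok F B" for F using that unfolding sel_def by (rule someI_ex)
    have "E \<subseteq> \<A>" unfolding E_def \<A>_def using sel unfolding ok_def by blast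
    moreover have "countable E"
      unfolding E_def by (intro countable_image countable_subset[OF _ \<N>(1)]) blast
    ultimately have E_in: "E \<in> ctbl \<A>" unfolding ctbl_def by blast
    have E_sub: "\<Union>E \<subseteq> U'" unfolding E_def using sel unfolding ok_def by blast
    have sub_E: "D \<inter> C \<subseteq> \<Union>E"
    proof
      fix d assume d: "d \<in> D \<inter> C"
      then have "d \<in> D" by blast
      from bspec[OF \<N>(2)[unfolded compact_network_def] this]
      obtain K where K: "d \<in> K" "compactin T K" "K \<subseteq> D"
        and net: "\<forall>U. openin T U \<and> K \<subseteq> U \<longrightarrow> (\<exists>F\<in>\<N>. K \<subseteq> F \<and> F \<subseteq> U)"
        by (elim exE conjE)
      define Q where "Q = topspace T - U'"
      have Q: "closedin T Q" unfolding Q_def using U'(1) by blast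
      have CQ: "C \<inter> Q = {}" using V(5) unfolding Q_def by blast
      have b0: "\<forall>x\<in>K. \<forall>y\<in>K. x \<noteq> y \<longrightarrow>
          b x y \<in> \<B>0 \<and> openin T (b x y) \<and> x \<in> b x y \<and> y \<notin> T closure_of b x y"
        using b K(3) unfolding \<B>0_def by blast
      from compact_separation[OF K(2) V(2) Q CQ b0] obtain \<G> where
        \<G>: "finite \<G>" "\<forall>\<H>\<in>\<G>. finite \<H> \<and> \<H> \<subseteq> \<B>0" "\<forall>\<H>\<in>\<G>. openin T (topspace T \<inter> \<Inter>\<H>)"
        and sep: "K \<inter> C \<subseteq> (\<Union>\<H>\<in>\<G>. topspace T \<inter> \<Inter>\<H>)"
          "K \<inter> Q \<inter> T closure_of (\<Union>\<H>\<in>\<G>. topspace T \<inter> \<Inter>\<H>) = {}"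
        by (elim exE conjE)
      define B where "B = (\<Union>\<H>\<in>\<G>. topspace T \<inter> \<Inter>\<H>)"
      have "\<G> \<subseteq> ctbl \<B>0" using \<G>(2) countable_finite unfolding ctbl_def by blast
      then have "(\<lambda>\<H>. topspace T \<inter> \<Inter>\<H>) ` \<G> \<subseteq> \<B>1" unfolding \<B>1_def by (rule image_mono)
      then have "(\<lambda>\<H>. topspace T \<inter> \<Inter>\<H>) ` \<G> \<in> ctbl \<B>1"
        using \<G>(1) by (simp add: ctbl_def countable_finite)
      then have B2: "B \<in> \<B>2" unfolding \<B>2_def B_def by blast
      have B_open: "openin T B" unfolding B_def using \<G>(3) by blast
      have B_cl: "B \<subseteq> T closure_of B" by (rule closure_of_subset[OF openin_subset[OF B_open]])
      \<comment> \<open>In \<open>U0\<close> every point of C belongs to B, and every point of the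
        closure of B belongs to U'. Both conditions are open and hold on K, so a network member F
        inside \<open>U0\<close> inherits the separation.\<close>
      define U0 where "U0 = (B \<union> (topspace T - C)) \<inter> (U' \<union> (topspace T - T closure_of B))"
      have "openin T U0"
        unfolding U0_def using B_open U'(1) V(2) by (intro openin_Int openin_Un openin_diff) auto
      moreover have "K \<subseteq> U0"
        using sep compactin_subset_topspace[OF K(2)] unfolding U0_def B_def[symmetric] Q_def by blast
      ultimately obtain F where F: "F \<in> \<N>" "K \<subseteq> F" "F \<subseteq> U0" using net by blast
      have "ok F B" using F(3) B2 B_cl unfolding ok_def U0_def by blast
      then have "F \<inter> sel F \<in> E" "ok F (sel F)" using F(1) sel unfolding E_def by blast+
      moreover from this(2) have "d \<in> F \<inter> sel F" using d K(1) F(2) unfolding ok_def by blast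
      ultimately show "d \<in> \<Union>E" by blast
    qed
    define W where "W = T interior_of (T closure_of (D \<inter> \<Union>E))"
    \<comment> \<open>Density of \<open>D\<close> recovers the open set V from its trace, and that
      trace lies in the union of E because V \<subseteq> C.\<close>
    have "V \<subseteq> T closure_of (V \<inter> D)"
      using openin_Int_closure_of_subset[OF V(1), of D] openin_subset[OF V(1)] D(2) by blast
    also have "\<dots> \<subseteq> T closure_of (D \<inter> \<Union>E)"
      by (rule closure_of_mono) (use sub_E V(4) in blast)
    finally have "V \<subseteq> W" unfolding W_def by (rule interior_of_maximal[OF _ V(1)])
    moreover have "T closure_of (D \<inter> \<Union>E) \<subseteq> C'"
      by (rule closure_of_minimal[OF _ U'(2)]) (use E_sub U'(4) in blast)
    then have "W \<subseteq> U" using interior_of_subset U'(5) unfolding W_def by fast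
    moreover have "W \<in> \<B>" unfolding W_def \<B>_def by (rule imageI[OF E_in])
    ultimately show "\<exists>V\<in>\<B>. p \<in> V \<and> V \<subseteq> U" using V(3) by blast
  qed
  ultimately show ?thesis by blast
qed

section \<open>Topological groups\<close>

text \<open>\<open>X\<close> may have more points than \<open>S\<close>, so \<open>\<Phi>\<close>
  adds all of \<open>X\<close> and its inverses whatever \<open>E\<close> is. After that only finite
  \<open>E\<close> matter: the empty set yields the unit and the generators with their inverses, a
  pair yields a product.\<close>

lemma card_of_generate_le_Pow:
  fixes S :: "'c set"
  assumes S: "infinite S" and X: "|X| \<le>o |Pow S|"
  shows "|generate G X| \<le>o |Pow S|"
proof -
  define \<Phi> where "\<Phi> E = ({\<one>\<^bsub>G\<^esub>} \<union> X) \<union> ((\<lambda>x. inv\<^bsub>G\<^esub> x) ` X \<union> (\<lambda>(x, y). x \<otimes>\<^bsub>G\<^esub> y) ` (E \<times> E))" for E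
  have inf: "infinite (Pow S)" using S by simp
  have \<Phi>_card: "|\<Phi> E| \<le>o |Pow S|" if E: "|E| \<le>o |S|" for E
  proof -
    have "|S| \<le>o |Pow S|" by (rule ordLess_imp_ordLeq[OF card_of_Pow])
    then have "|E| \<le>o |Pow S|" by (rule ordLeq_transitive[OF E])
    then have "|E \<times> E| \<le>o |Pow S|" by (intro card_of_Times_ordLeq_infinite inf)
    moreover have "|{\<one>\<^bsub>G\<^esub>}| \<le>o |Pow S|" by (rule card_of_singl_ordLeq) (rule Pow_not_empty)
    ultimately show ?thesis
      unfolding \<Phi>_def by (intro card_of_Un_ordLeq_infinite inf card_of_image_le X)
  qed
  have "\<exists>A. |A| \<le>o |Pow S| \<and> (\<forall>E. E \<subseteq> A \<and> |E| \<le>o |S| \<longrightarrow> \<Phi> E \<subseteq> A)"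
    by (rule closing_off[OF S]) (rule \<Phi>_card)
  then obtain A where A_card: "|A| \<le>o |Pow S|"
    and A_closed: "\<forall>E. E \<subseteq> A \<and> |E| \<le>o |S| \<longrightarrow> \<Phi> E \<subseteq> A"
    by (elim exE conjE)
  have \<Phi>_fin: "\<Phi> E \<subseteq> A" if "finite E" "E \<subseteq> A" for E
    by (rule A_closed[rule_format, OF conjI, OF that(2) countable_card_of_le_infinite[OF S countable_finite[OF that(1)]]])
  have "g \<in> A" if "g \<in> generate G X" for g
    using that
  proof (induction rule: generate.induct)
    case one
    then show ?case using \<Phi>_fin[of "{}"] unfolding \<Phi>_def by blast
  next
    case (incl h)
    then show ?case using \<Phi>_fin[of "{}"] unfolding \<Phi>_def by blast
  next
    case (inv h)
    then show ?case using \<Phi>_fin[of "{}"] unfolding \<Phi>_def by blast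
  next
    case (eng g h)
    then show ?case using \<Phi>_fin[of "{g, h}"] unfolding \<Phi>_def by blast
  qed
  then have "generate G X \<subseteq> A" by blast
  then show ?thesis using A_card by (rule card_of_subset_le)
qed

lemma topological_group_regular_space:
  assumes "topological_group G T"
  shows "regular_space T"
proof -
  interpret group G using assms unfolding topological_group_def by blast
  have top: "topspace T = carrier G"
    and mult: "continuous_map (prod_topology T T) T (\<lambda>(x, y). x \<otimes>\<^bsub>G\<^esub> y)"
    and inv: "continuous_map T T (\<lambda>x. inv\<^bsub>G\<^esub> x)"
    using assms unfolding topological_group_def by blast+
  show ?thesis
    unfolding neighbourhood_base_of_closedin[symmetric] neighbourhood_base_of
  proof (intro allI impI, elim conjE)
    \<comment> \<open>If V W is contained in U for neighbourhoods V of p and W of the unit, then so is the closure of V.\<close>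
    fix U p assume U: "openin T U" and p: "p \<in> U"
    then have pG: "p \<in> carrier G" using openin_subset top by blast
    define P where "P = {z \<in> topspace (prod_topology T T). (\<lambda>(x, y). x \<otimes>\<^bsub>G\<^esub> y) z \<in> U}"
    have "openin (prod_topology T T) P"
      unfolding P_def by (rule openin_continuous_map_preimage[OF mult U])
    moreover have "(p, \<one>\<^bsub>G\<^esub>) \<in> P" unfolding P_def using pG p top by simp
    ultimately obtain V W where VW: "openin T V" "openin T W" "p \<in> V" "\<one>\<^bsub>G\<^esub> \<in> W" "V \<times> W \<subseteq> P"
      unfolding openin_prod_topology_alt by metis
    have "T closure_of V \<subseteq> U"
    proof
      fix z assume z: "z \<in> T closure_of V"
      then have zG: "z \<in> carrier G" using closure_of_subset_topspace top by fast
      \<comment> \<open>\<open>Q\<close> is a neighbourhood of z, so it meets V in some v; then z is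
        the product of v in V and v^(-1) z in W.\<close>
      define Q where "Q = {y \<in> topspace T. inv\<^bsub>G\<^esub> y \<otimes>\<^bsub>G\<^esub> z \<in> W}"
      have "continuous_map T (prod_topology T T) (\<lambda>y. (inv\<^bsub>G\<^esub> y, z))"
        using inv zG top by (simp add: continuous_map_paired)
      from continuous_map_compose[OF this mult]
      have "continuous_map T T (\<lambda>y. inv\<^bsub>G\<^esub> y \<otimes>\<^bsub>G\<^esub> z)" by (simp add: o_def)
      then have "openin T Q" unfolding Q_def by (rule openin_continuous_map_preimage[OF _ VW(2)])
      moreover have "z \<in> Q" using zG VW(4) top unfolding Q_def by simp
      ultimately obtain v where v: "v \<in> V" "v \<in> Q" using z unfolding in_closure_of by blast
      have vG: "v \<in> carrier G" using v(2) top unfolding Q_def by blast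
      have "(v, inv\<^bsub>G\<^esub> v \<otimes>\<^bsub>G\<^esub> z) \<in> P" using v VW(5) unfolding Q_def by blast
      then have "v \<otimes>\<^bsub>G\<^esub> (inv\<^bsub>G\<^esub> v \<otimes>\<^bsub>G\<^esub> z) \<in> U" unfolding P_def by simp
      then show "z \<in> U" using vG zG by (simp add: m_assoc[symmetric])
    qed
    moreover have "V \<subseteq> T closure_of V" by (rule closure_of_subset[OF openin_subset[OF VW(1)]])
    ultimately show "\<exists>V C. openin T V \<and> closedin T C \<and> p \<in> V \<and> V \<subseteq> C \<and> C \<subseteq> U"
      using VW(1,3) by (intro exI[of _ V] exI[of _ "T closure_of V"] conjI closedin_closure_of)
  qed
qed

text \<open>Closing the network under pointwise inverses and products takes \<omega> stages and
  keeps it countable. Induction over \<open>generate\<close> then gives each element a compact set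
  of its own, built from those of the generators by the same operations.\<close>

lemma compact_network_generate:
  assumes G: "topological_group G T" and X: "X \<subseteq> topspace T"
    and \<N>: "countable \<N>" "compact_network T X \<N>"
  obtains \<N>' where "countable \<N>'" "compact_network T (generate G X) \<N>'"
proof -
  interpret group G using G unfolding topological_group_def by blast
  have top: "topspace T = carrier G"
    and mult: "continuous_map (prod_topology T T) T (\<lambda>(x, y). x \<otimes>\<^bsub>G\<^esub> y)"
    and inv: "continuous_map T T (\<lambda>x. inv\<^bsub>G\<^esub> x)"
    using G unfolding topological_group_def by blast+
  define m where "m = (\<lambda>(x, y). x \<otimes>\<^bsub>G\<^esub> y)"
  define step where "step \<F> = \<F> \<union> (`) (\<lambda>x. inv\<^bsub>G\<^esub> x) ` \<F> \<union> (\<lambda>(A, B). m ` (A \<times> B)) ` (\<F> \<times> \<F>)"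
    for \<F> :: "'a set set"
  \<comment> \<open>The singleton of the unit enters at the start to serve as network member for the
    unit. The stages increase, so any two sets of the limit family occur together at some
    stage.\<close>
  define N where "N n = (step ^^ n) (insert {\<one>\<^bsub>G\<^esub>} \<N>)" for n
  have N_Suc: "N (Suc n) = step (N n)" for n unfolding N_def by simp
  have N_mono: "N k \<subseteq> N n" if "k \<le> n" for k n
    using that by (rule lift_Suc_mono_le[rotated]) (auto simp: N_Suc step_def)
  have cnt: "countable (N n)" for n
  proof (induction n)
    case 0
    then show ?case using \<N>(1) by (simp add: N_def)
  next
    case (Suc n)
    then show ?case unfolding N_Suc step_def by (intro countable_Un countable_image countable_SIGMA)
  qed
  define \<N>' where "\<N>' = (\<Union>n. N n)"
  have sub: "\<N> \<subseteq> \<N>'" and one_in: "{\<one>\<^bsub>G\<^esub>} \<in> \<N>'"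
    unfolding \<N>'_def using N_def[of 0] by auto
  have inv_closed: "(\<lambda>x. inv\<^bsub>G\<^esub> x) ` A \<in> \<N>'" if A: "A \<in> \<N>'" for A
  proof -
    obtain n where "A \<in> N n" using A unfolding \<N>'_def by blast
    then have "(\<lambda>x. inv\<^bsub>G\<^esub> x) ` A \<in> N (Suc n)" unfolding N_Suc step_def by blast
    then show ?thesis unfolding \<N>'_def by blast
  qed
  have mult_closed: "m ` (A \<times> B) \<in> \<N>'" if AB: "A \<in> \<N>'" "B \<in> \<N>'" for A B
  proof -
    obtain k l where "A \<in> N k" "B \<in> N l" using AB unfolding \<N>'_def by blast
    then have "A \<in> N (max k l)" "B \<in> N (max k l)"
      using N_mono[of k "max k l"] N_mono[of l "max k l"] by auto
    then have "m ` (A \<times> B) \<in> N (Suc (max k l))" unfolding N_Suc step_def by blast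
    then show ?thesis unfolding \<N>'_def by blast
  qed
  \<comment> \<open>This keeps the part of the network condition that mentions neither a point nor a
    containing set, so inverses and products preserve it directly.\<close>
  define good where "good K \<longleftrightarrow> compactin T K \<and>
    (\<forall>U. openin T U \<and> K \<subseteq> U \<longrightarrow> (\<exists>F\<in>\<N>'. K \<subseteq> F \<and> F \<subseteq> U))" for K
  have good_inv: "good ((\<lambda>x. inv\<^bsub>G\<^esub> x) ` K)" if K: "good K" for K
    unfolding good_def
  proof (intro conjI allI impI)
    show "compactin T ((\<lambda>x. inv\<^bsub>G\<^esub> x) ` K)"
      by (rule image_compactin[OF _ inv]) (use K in \<open>simp add: good_def\<close>)
    fix U assume "openin T U \<and> (\<lambda>x. inv\<^bsub>G\<^esub> x) ` K \<subseteq> U"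
    then have U: "openin T U" "(\<lambda>x. inv\<^bsub>G\<^esub> x) ` K \<subseteq> U" by simp_all
    have "K \<subseteq> topspace T" by (rule compactin_subset_topspace) (use K in \<open>simp add: good_def\<close>)
    then have "K \<subseteq> {x \<in> topspace T. inv\<^bsub>G\<^esub> x \<in> U}" using U(2) by blast
    moreover have "openin T {x \<in> topspace T. inv\<^bsub>G\<^esub> x \<in> U}"
      by (rule openin_continuous_map_preimage[OF inv U(1)])
    ultimately obtain F where F: "F \<in> \<N>'" "K \<subseteq> F" "F \<subseteq> {x \<in> topspace T. inv\<^bsub>G\<^esub> x \<in> U}"
      using K unfolding good_def by blast
    have "(\<lambda>x. inv\<^bsub>G\<^esub> x) ` F \<subseteq> U" using F(3) by blast
    then show "\<exists>F\<in>\<N>'. (\<lambda>x. inv\<^bsub>G\<^esub> x) ` K \<subseteq> F \<and> F \<subseteq> U"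
      by (intro bexI[OF _ inv_closed[OF F(1)]] conjI image_mono F(2))
  qed
  have good_mult: "good (m ` (K \<times> L))" if KL: "good K" "good L" for K L
    unfolding good_def
  proof (intro conjI allI impI)
    have cpt: "compactin T K" "compactin T L" using KL by (simp_all add: good_def)
    have "compactin (prod_topology T T) (K \<times> L)" using cpt by (simp add: compactin_Times)
    then show "compactin T (m ` (K \<times> L))" unfolding m_def by (rule image_compactin[OF _ mult])
    fix U assume "openin T U \<and> m ` (K \<times> L) \<subseteq> U"
    then have U: "openin T U" "m ` (K \<times> L) \<subseteq> U" by simp_all
    define P where "P = {z \<in> topspace (prod_topology T T). m z \<in> U}"
    have P: "openin (prod_topology T T) P"
      unfolding P_def m_def by (rule openin_continuous_map_preimage[OF mult U(1)])
    have "K \<times> L \<subseteq> topspace (prod_topology T T)"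
      using cpt[THEN compactin_subset_topspace] by auto
    then have "K \<times> L \<subseteq> P" using U(2) unfolding P_def by blast
    \<comment> \<open>The open box between the compact product and \<open>P\<close> lets network
      members for the two factors be chosen independently; their product set is again in the
      network.\<close>
    then obtain V W where VW: "openin T V" "openin T W" "K \<subseteq> V" "L \<subseteq> W" "V \<times> W \<subseteq> P"
      by (rule Wallace_theorem_prod_topology[OF cpt P])
    obtain A where A: "A \<in> \<N>'" "K \<subseteq> A" "A \<subseteq> V" using KL(1) VW(1,3) unfolding good_def by blast
    obtain B where B: "B \<in> \<N>'" "L \<subseteq> B" "B \<subseteq> W" using KL(2) VW(2,4) unfolding good_def by blast
    have "A \<times> B \<subseteq> P" using A(3) B(3) VW(5) by blast
    then have "m ` (A \<times> B) \<subseteq> U" unfolding P_def by blast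
    moreover have "m ` (K \<times> L) \<subseteq> m ` (A \<times> B)" using A(2) B(2) by blast
    ultimately show "\<exists>F\<in>\<N>'. m ` (K \<times> L) \<subseteq> F \<and> F \<subseteq> U"
      by (intro bexI[OF _ mult_closed[OF A(1) B(1)]] conjI)
  qed
  have good_X: "\<exists>K. h \<in> K \<and> K \<subseteq> X \<and> good K" if h: "h \<in> X" for h
  proof -
    obtain K where K: "h \<in> K" "compactin T K" "K \<subseteq> X"
      and net: "\<forall>U. openin T U \<and> K \<subseteq> U \<longrightarrow> (\<exists>F\<in>\<N>. K \<subseteq> F \<and> F \<subseteq> U)"
      using bspec[OF \<N>(2)[unfolded compact_network_def] h] by (elim exE conjE)
    have "\<exists>F\<in>\<N>'. K \<subseteq> F \<and> F \<subseteq> U" if U: "openin T U" "K \<subseteq> U" for U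
    proof -
      obtain F where "F \<in> \<N>" "K \<subseteq> F" "F \<subseteq> U" using net U by blast
      then show ?thesis using sub by blast
    qed
    then have "good K" using K(2) by (simp add: good_def)
    with K show ?thesis by blast
  qed
  have "\<exists>K. d \<in> K \<and> K \<subseteq> generate G X \<and> good K" if "d \<in> generate G X" for d
    using that
  proof (induction rule: generate.induct)
    case one
    have "compactin T {\<one>\<^bsub>G\<^esub>}" using top by simp
    then have "good {\<one>\<^bsub>G\<^esub>}" using one_in by (auto simp: good_def)
    then show ?case using generate.one[of G X] by blast
  next
    case (incl h)
    then show ?case using good_X[OF incl] generate.incl[of _ X G] by blast
  next
    case (inv h)
    then obtain K where K: "h \<in> K" "K \<subseteq> X" "good K" using good_X by blast
    then have "(\<lambda>x. inv\<^bsub>G\<^esub> x) ` K \<subseteq> generate G X" using generate.inv[of _ X G] by blast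
    then show ?case using good_inv[OF K(3)] K(1) by blast
  next
    case (eng g h)
    then obtain K L where KL: "g \<in> K" "K \<subseteq> generate G X" "good K"
      "h \<in> L" "L \<subseteq> generate G X" "good L" by blast
    have "m ` (K \<times> L) \<subseteq> generate G X"
      using KL(2,5) generate.eng[of _ G X] unfolding m_def by auto
    moreover have "g \<otimes>\<^bsub>G\<^esub> h \<in> m ` (K \<times> L)" using KL(1,4) unfolding m_def by force
    ultimately show ?case
      using good_mult[OF KL(3,6)] by (intro exI[of _ "m ` (K \<times> L)"] conjI)
  qed
  then have "compact_network T (generate G X) \<N>'"
    by (simp add: compact_network_def good_def conj_left_commute)
  moreover have "countable \<N>'" unfolding \<N>'_def using cnt by simp
  ultimately show thesis using that by blast
qed

text \<open>Cardinal functions are expressed by witnesses. Every base of T yields one of X no larger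
  than |B| + \<omega>, the \<omega> reflecting the convention that weights are infinite. Taking
  \<open>S\<close> of size \<psi>(X) in the second conjunct gives a base of T of size at most
  2^\<psi>(X).\<close>

theorem mainTheorem8:
  fixes G :: "('g, 'b) monoid_scheme" and T :: "'g topology" and X :: "'g set"
    and S :: "'c set"
  assumes "topological_group G T"
    and "Hausdorff_space T"
    and "X \<subseteq> topspace T"
    and "lindelof_sigma (subtopology T X)"
    and "T closure_of (generate G X) = topspace T"
  shows "(\<forall>B. is_base T B \<longrightarrow>
            (\<exists>B'. is_base (subtopology T X) B' \<and> (card_of B', BNF_Cardinal_Arithmetic.csum (card_of B) natLeq) \<in> ordLeq))
       \<and> ((infinite S \<and>
           (\<forall>x\<in>X. \<exists>\<U>. (\<forall>U\<in>\<U>. openin (subtopology T X) U \<and> x \<in> U) \<and> \<Inter>\<U> = {x}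
                     \<and> (card_of \<U>, card_of S) \<in> ordLeq))
         \<longrightarrow> (\<exists>B. is_base T B \<and> (card_of B, card_of (Pow S)) \<in> ordLeq))"
proof (intro conjI allI impI)
  fix B assume B: "is_base T B"
  have "is_base (subtopology T X) ((\<lambda>U. U \<inter> X) ` B)"
    unfolding is_base_def
  proof (intro conjI ballI allI impI)
    show "openin (subtopology T X) V" if "V \<in> (\<lambda>U. U \<inter> X) ` B" for V
      using B that unfolding is_base_def by (auto intro: openin_subtopology_Int)
    fix U x assume "openin (subtopology T X) U \<and> x \<in> U"
    then obtain U' where U': "openin T U'" "U = U' \<inter> X" "x \<in> U'" "x \<in> X"
      unfolding openin_subtopology by blast
    from B U'(1,3) have "\<exists>V\<in>B. x \<in> V \<and> V \<subseteq> U'" by (simp add: is_base_def)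
    then obtain V where V: "V \<in> B" "x \<in> V" "V \<subseteq> U'" by blast
    have "V \<inter> X \<in> (\<lambda>U. U \<inter> X) ` B" using V(1) by (rule imageI)
    moreover have "x \<in> V \<inter> X \<and> V \<inter> X \<subseteq> U" using V(2,3) U'(2,4) by blast
    ultimately show "\<exists>V\<in>(\<lambda>U. U \<inter> X) ` B. x \<in> V \<and> V \<subseteq> U" by (rule rev_bexI)
  qed
  moreover have "|(\<lambda>U. U \<inter> X) ` B| \<le>o BNF_Cardinal_Arithmetic.csum |B| natLeq"
    by (intro card_of_image_le ordLeq_csum1 card_of_Card_order)
  ultimately show "\<exists>B'. is_base (subtopology T X) B' \<and>
      |B'| \<le>o BNF_Cardinal_Arithmetic.csum |B| natLeq"
    by (intro exI conjI)
next
  assume *: "infinite S \<and> (\<forall>x\<in>X. \<exists>\<U>. (\<forall>U\<in>\<U>. openin (subtopology T X) U \<and> x \<in> U) \<and>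
    \<Inter>\<U> = {x} \<and> |\<U>| \<le>o |S| )"
  then have S: "infinite S" by (rule conjunct1)
  have top: "topspace (subtopology T X) = X" using assms(3) by auto
  have "|topspace (subtopology T X)| \<le>o |Pow S|"
    by (rule lindelof_sigma_card_le_Pow[OF assms(4) S], unfold top) (rule bspec[OF conjunct2[OF *]])
  then have "|X| \<le>o |Pow S|" unfolding top .
  then have D: "|generate G X| \<le>o |Pow S|" by (rule card_of_generate_le_Pow[OF S])
  obtain \<N> where "countable \<N>" "compact_network T X \<N>"
    by (rule lindelof_sigma_compact_network[OF assms(4,3)])
  then obtain \<N>' where \<N>': "countable \<N>'" "compact_network T (generate G X) \<N>'"
    by (rule compact_network_generate[OF assms(1,3)])
  have "generate G X \<subseteq> topspace T"
    using assms(1,3) group.generate_incl unfolding topological_group_def by metis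
  then show "\<exists>B. is_base T B \<and> |B| \<le>o |Pow S|"
    by (rule weight_le_Pow_of_dense_compact_network[OF S
        topological_group_regular_space[OF assms(1)] assms(2) _ assms(5) D \<N>'])
qed

end
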